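(* For $\mathfrak{z}>0$ let $\mathcal{E}(\mathfrak{z})=\{\boldsymbol{\theta}\in\Theta:L(\widetilde{\boldsymbol{\theta}},\boldsymbol{\theta})\le\mathfrak{z}\}$; for $r>0$ let $\mathcal{A}(r,\boldsymbol{\theta}_0)=\{\boldsymbol{\theta}\in\Theta:\mathfrak{M}(\boldsymbol{\theta},\boldsymbol{\theta}_0)\le r\}$ and $\mu_*(r)=\inf_{\boldsymbol{\theta}\in\mathcal{A}(r,\boldsymbol{\theta}_0)}\mu(\boldsymbol{\theta})$. Then for any $\mathfrak{z}>0$, any $\rho,s\in[0,1)$ and any $r>0$, $$\mathbb{P}\big(\boldsymbol{\theta}_0\notin\mathcal{E}(\mathfrak{z})\big)\le\mathfrak{Q}(\rho,0)\exp\{-\rho\mu_*(r)\mathfrak{z}\}+\mathfrak{Q}(\rho,s)\exp\{-\rho s r\}.$$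
   Context: $L(\boldsymbol{\theta})$, $\boldsymbol{\theta}\in\Theta\subset\mathbb{R}^p$, is a separable real-valued random field on a probability space $(\Omega,\mathcal{F},\mathbb{P})$ with expectation $\mathbb{E}$, and $\mathbb{E}L(\boldsymbol{\theta})$ exists for all $\boldsymbol{\theta}\in\Theta$. Notation: $L(\boldsymbol{\theta},\boldsymbol{\theta}')=L(\boldsymbol{\theta})-L(\boldsymbol{\theta}')$. The point $\boldsymbol{\theta}_0\in\Theta$ is a maximizer of $\boldsymbol{\theta}\mapsto\mathbb{E}L(\boldsymbol{\theta})$, and the (random) minimum contrast estimator $\widetilde{\boldsymbol{\theta}}\in\Theta$ is a maximizer of $\boldsymbol{\theta}\mapsto L(\boldsymbol{\theta})$ over $\Theta$. It is assumed that for every $\boldsymbol{\theta}\in\Theta$ the set $\Upsilon(\boldsymbol{\theta})=\{\mu\in(0,\infty):\mathbb{E}\exp\{\mu L(\boldsymbol{\theta},\boldsymbol{\theta}_0)\}<\infty\}$ is non-empty; a function $\mu(\cdot)$ with $\mu(\boldsymbol{\theta})\in\Upsilon(\boldsymbol{\theta})$ is fixed, and $\mathfrak{M}(\boldsymbol{\theta},\boldsymbol{\theta}_0)=-\log\mathbb{E}\exp\{\mu(\boldsymbol{\theta})L(\boldsymbol{\theta},\boldsymbol{\theta}_0)\}$. For $\rho,s\in[0,1]$, $$\mathfrak{Q}(\rho,s)=\mathbb{E}\sup_{\boldsymbol{\theta}\in\Theta}\exp\Big\{\rho\big[\mu(\boldsymbol{\theta})L(\boldsymbol{\theta},\boldsymbol{\theta}_0)+s\,\mathfrak{M}(\boldsymbol{\theta},\boldsymbol{\theta}_0)\big]\Big\}.$$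 *)

theory Defs
  imports "HOL-Probability.Probability"
begin

text \<open>Doob separability: outside a single null set, the whole field is recovered, in the sense
  of graph closure, from its restriction to one countable separating set.\<close>

definition separable_random_field ::
  "'w measure \<Rightarrow> 'a::metric_space set \<Rightarrow> ('a \<Rightarrow> 'w \<Rightarrow> real) \<Rightarrow> bool" where
  "separable_random_field P \<Theta> L \<longleftrightarrow>
     (\<forall>\<theta>\<in>\<Theta>. L \<theta> \<in> borel_measurable P) \<and>
     (\<exists>T N. countable T \<and> T \<subseteq> \<Theta> \<and> N \<in> null_sets P \<and>
        (\<forall>\<omega>\<in>space P - N. \<forall>\<theta>\<in>\<Theta>. \<forall>\<epsilon>>0.
           L \<theta> \<omega> \<in> closure ((\<lambda>\<theta>'. L \<theta>' \<omega>) ` (T \<inter> ball \<theta> \<epsilon>))))"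

definition contrast_diff :: "('a \<Rightarrow> 'w \<Rightarrow> real) \<Rightarrow> 'a \<Rightarrow> 'a \<Rightarrow> 'w \<Rightarrow> real" where
  "contrast_diff L \<theta> \<theta>' \<omega> = L \<theta> \<omega> - L \<theta>' \<omega>"

definition Upsilon :: "'w measure \<Rightarrow> ('a \<Rightarrow> 'w \<Rightarrow> real) \<Rightarrow> 'a \<Rightarrow> 'a \<Rightarrow> real set" where
  "Upsilon P L \<theta>0 \<theta> =
     {m. 0 < m \<and> (\<integral>\<^sup>+\<omega>. ennreal (exp (m * contrast_diff L \<theta> \<theta>0 \<omega>)) \<partial>P) < \<infinity>}"

definition rate_M :: "'w measure \<Rightarrow> ('a \<Rightarrow> 'w \<Rightarrow> real) \<Rightarrow> ('a \<Rightarrow> real) \<Rightarrow> 'a \<Rightarrow> 'a \<Rightarrow> real" where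
  "rate_M P L \<mu> \<theta>0 \<theta> =
     - ln (prob_space.expectation P (\<lambda>\<omega>. exp (\<mu> \<theta> * contrast_diff L \<theta> \<theta>0 \<omega>)))"

text \<open>The function \<open>\<mu>\<close> is not assumed to be regular, so a supremum over the uncountable parameter
  set need not be measurable even though the field is separable, and for non-measurable integrands
  \<open>nn_integral\<close> is a lower integral. Expectations of suprema are therefore taken as outer
  expectations; by the lemma below these are ordinary expectations as soon as the integrand is
  measurable with respect to the completed probability space.\<close>

definition outer_expectation :: "'w measure \<Rightarrow> ('w \<Rightarrow> ennreal) \<Rightarrow> ennreal" where
  "outer_expectation P f =
     (INF g \<in> {g \<in> borel_measurable P. \<forall>\<omega>\<in>space P. f \<omega> \<le> g \<omega>}. \<integral>\<^sup>+\<omega>. g \<omega> \<partial>P)"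

lemma outer_expectation_eq_nn_integral:
  assumes "f \<in> borel_measurable (completion P)"
  shows "outer_expectation P f = (\<integral>\<^sup>+\<omega>. f \<omega> \<partial>completion P)"
proof (rule antisym)
  obtain g where g: "g \<in> borel_measurable P" "AE \<omega> in P. f \<omega> = g \<omega>"
    using completion_ex_borel_measurable[OF assms] by auto
  obtain N where N: "{\<omega> \<in> space P. f \<omega> \<noteq> g \<omega>} \<subseteq> N" "N \<in> sets P" "emeasure P N = 0"
    using g(2) by (auto elim: AE_E)
  define h where "h = (\<lambda>\<omega>. if \<omega> \<in> N then \<infinity> else g \<omega>)"
  have h: "h \<in> borel_measurable P" "\<forall>\<omega>\<in>space P. f \<omega> \<le> h \<omega>"
    using g(1) N by (auto simp: h_def)
  have NN: "N \<in> null_sets P" using N by auto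
  have ae: "AE \<omega> in completion P. f \<omega> = h \<omega>"
    using g(2) AE_not_in[OF NN] by (intro AE_completion) (auto simp: h_def)
  have "outer_expectation P f \<le> (\<integral>\<^sup>+\<omega>. h \<omega> \<partial>P)"
    unfolding outer_expectation_def using h by (intro INF_lower) auto
  also have "\<dots> = (\<integral>\<^sup>+\<omega>. h \<omega> \<partial>completion P)"
    using h(1) by (simp add: nn_integral_completion)
  also have "\<dots> = (\<integral>\<^sup>+\<omega>. f \<omega> \<partial>completion P)"
    using ae by (intro nn_integral_cong_AE) auto
  finally show "outer_expectation P f \<le> (\<integral>\<^sup>+\<omega>. f \<omega> \<partial>completion P)" .
  show "(\<integral>\<^sup>+\<omega>. f \<omega> \<partial>completion P) \<le> outer_expectation P f"
    unfolding outer_expectation_def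
  proof (rule INF_greatest)
    fix g assume "g \<in> {g \<in> borel_measurable P. \<forall>\<omega>\<in>space P. f \<omega> \<le> g \<omega>}"
    then have g: "g \<in> borel_measurable P" "\<forall>\<omega>\<in>space P. f \<omega> \<le> g \<omega>" by auto
    have "(\<integral>\<^sup>+\<omega>. f \<omega> \<partial>completion P) \<le> (\<integral>\<^sup>+\<omega>. g \<omega> \<partial>completion P)"
      using g(2) by (intro nn_integral_mono) simp
    then show "(\<integral>\<^sup>+\<omega>. f \<omega> \<partial>completion P) \<le> (\<integral>\<^sup>+\<omega>. g \<omega> \<partial>P)"
      using g(1) by (simp add: nn_integral_completion)
  qed
qed

definition Q_sup ::
  "'w measure \<Rightarrow> 'a set \<Rightarrow> ('a \<Rightarrow> 'w \<Rightarrow> real) \<Rightarrow> ('a \<Rightarrow> real) \<Rightarrow> 'a \<Rightarrow> real \<Rightarrow> real \<Rightarrow> ennreal" where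
  "Q_sup P \<Theta> L \<mu> \<theta>0 \<rho> s =
     outer_expectation P (\<lambda>\<omega>. SUP \<theta>\<in>\<Theta>.
       ennreal (exp (\<rho> * (\<mu> \<theta> * contrast_diff L \<theta> \<theta>0 \<omega> + s * rate_M P L \<mu> \<theta>0 \<theta>))))"

definition conf_set ::
  "'a set \<Rightarrow> ('a \<Rightarrow> 'w \<Rightarrow> real) \<Rightarrow> ('w \<Rightarrow> 'a) \<Rightarrow> real \<Rightarrow> 'w \<Rightarrow> 'a set" where
  "conf_set \<Theta> L \<theta>est z \<omega> = {\<theta>\<in>\<Theta>. contrast_diff L (\<theta>est \<omega>) \<theta> \<omega> \<le> z}"

definition local_set ::
  "'w measure \<Rightarrow> 'a set \<Rightarrow> ('a \<Rightarrow> 'w \<Rightarrow> real) \<Rightarrow> ('a \<Rightarrow> real) \<Rightarrow> real \<Rightarrow> 'a \<Rightarrow> 'a set" where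
  "local_set P \<Theta> L \<mu> r \<theta>0 = {\<theta>\<in>\<Theta>. rate_M P L \<mu> \<theta>0 \<theta> \<le> r}"

text \<open>For \<open>r > 0\<close> and \<open>\<theta>0 \<in> \<Theta>\<close> the index set contains \<open>\<theta>0\<close>, where the rate is \<open>0\<close>,
  and \<open>\<mu> > 0\<close>, so the real-valued infimum is a genuine one.\<close>

definition mu_star ::
  "'w measure \<Rightarrow> 'a set \<Rightarrow> ('a \<Rightarrow> 'w \<Rightarrow> real) \<Rightarrow> ('a \<Rightarrow> real) \<Rightarrow> 'a \<Rightarrow> real \<Rightarrow> real" where
  "mu_star P \<Theta> L \<mu> \<theta>0 r = (INF \<theta>\<in>local_set P \<Theta> L \<mu> r \<theta>0. \<mu> \<theta>)"

end

theory Submission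
  imports Defs
begin

text \<open>
  On the event that \<open>\<theta>0\<close> is missed, the excess \<open>X = L (\<theta>est) - L \<theta>0\<close> exceeds \<open>z > 0\<close>. The
  argument is the exponential Markov inequality, applied differently according to whether the
  estimator is close to \<open>\<theta>0\<close> or not, closeness being measured by the rate. If the rate at
  \<open>\<theta>est\<close> is at most \<open>r\<close>, then \<open>\<mu>\<close> is at least \<open>mu_star\<close> there, so
  \<open>exp (\<rho> \<mu> X)\<close> is at least \<open>exp (\<rho> mu_star z)\<close>. If the rate is larger than \<open>r\<close>, the positive
  term \<open>\<mu> X\<close> can be dropped and \<open>exp (\<rho> (\<mu> X + s rate))\<close> is at least \<open>exp (\<rho> s r)\<close>. Replacing
  the value at the random point \<open>\<theta>est\<close> by the supremum over \<open>\<Theta>\<close> bounds the indicator of the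
  event by a sum of two terms (\<open>one_le_sum_of_exp_sups\<close>), one for each case.

  Integrating this bound takes some care. The suprema need not be measurable, but each has a
  measurable majorant whose integral equals its outer expectation (\<open>outer_expectation_attained\<close>),
  and majorants can be added and scaled freely (\<open>emeasure_completion_le_outer_expectations\<close>).
  The event itself involves \<open>\<theta>est\<close>, which may be an arbitrary selection of maximizers; what
  matters is only the maximal value of the field, and by separability this is a
  countable supremum up to a null set (\<open>argmax_exceeds_in_completion\<close>).
\<close>

text \<open>Pointwise infima of countably many measurable majorants are again majorants, so a sequence
  that approximates the outer expectation can be merged into one optimal majorant.\<close>

lemma outer_expectation_attained:
  obtains g where "g \<in> borel_measurable P" "\<And>\<omega>. \<omega> \<in> space P \<Longrightarrow> f \<omega> \<le> g \<omega>"
    "(\<integral>\<^sup>+\<omega>. g \<omega> \<partial>P) = outer_expectation P f"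
proof -
  define G where "G = {g \<in> borel_measurable P. \<forall>\<omega>\<in>space P. f \<omega> \<le> g \<omega>}"
  have oe: "outer_expectation P f = Inf ((\<lambda>g. \<integral>\<^sup>+\<omega>. g \<omega> \<partial>P) ` G)"
    by (simp add: outer_expectation_def G_def)
  have "(\<lambda>_. \<infinity>) \<in> G"
    by (simp add: G_def)
  then have "(\<lambda>g. \<integral>\<^sup>+\<omega>. g \<omega> \<partial>P) ` G \<noteq> {}"
    by blast
  then obtain a :: "nat \<Rightarrow> ennreal" where a: "range a \<subseteq> (\<lambda>g. \<integral>\<^sup>+\<omega>. g \<omega> \<partial>P) ` G"
      and Inf_a: "outer_expectation P f = (INF i. a i)"
    unfolding oe by (metis ennreal_Inf_countable_INF)
  have "\<exists>g. g \<in> G \<and> a i = (\<integral>\<^sup>+\<omega>. g \<omega> \<partial>P)" for i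
    using a by (auto simp: image_subset_iff)
  then obtain g where g: "\<And>i. g i \<in> G" "\<And>i. a i = (\<integral>\<^sup>+\<omega>. g i \<omega> \<partial>P)"
    by metis
  define h where "h = (\<lambda>\<omega>. INF i. g i \<omega>)"
  have h: "h \<in> borel_measurable P" "\<And>\<omega>. \<omega> \<in> space P \<Longrightarrow> f \<omega> \<le> h \<omega>"
    using g(1) unfolding h_def G_def by (auto intro!: INF_greatest borel_measurable_INF)
  have "(\<integral>\<^sup>+\<omega>. h \<omega> \<partial>P) \<le> a i" for i
    unfolding g(2) h_def by (intro nn_integral_mono INF_lower) simp
  then have "(\<integral>\<^sup>+\<omega>. h \<omega> \<partial>P) \<le> outer_expectation P f"
    unfolding Inf_a by (rule INF_greatest)
  moreover have "outer_expectation P f \<le> (\<integral>\<^sup>+\<omega>. h \<omega> \<partial>P)"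
    unfolding outer_expectation_def using h by (intro INF_lower) auto
  ultimately have "(\<integral>\<^sup>+\<omega>. h \<omega> \<partial>P) = outer_expectation P f"
    by (rule antisym)
  with h show thesis
    by (rule that)
qed

lemma emeasure_completion_le_outer_expectations:
  assumes A: "A \<in> sets (completion P)"
    and bound: "\<And>\<omega>. \<omega> \<in> A \<Longrightarrow> 1 \<le> f1 \<omega> * c1 + f2 \<omega> * c2"
  shows "emeasure (completion P) A \<le> outer_expectation P f1 * c1 + outer_expectation P f2 * c2"
proof -
  obtain g1 where g1 [measurable]: "g1 \<in> borel_measurable P"
      and le1: "\<And>\<omega>. \<omega> \<in> space P \<Longrightarrow> f1 \<omega> \<le> g1 \<omega>"
      and int1: "(\<integral>\<^sup>+\<omega>. g1 \<omega> \<partial>P) = outer_expectation P f1"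
    using outer_expectation_attained[of P f1] by blast
  obtain g2 where g2 [measurable]: "g2 \<in> borel_measurable P"
      and le2: "\<And>\<omega>. \<omega> \<in> space P \<Longrightarrow> f2 \<omega> \<le> g2 \<omega>"
      and int2: "(\<integral>\<^sup>+\<omega>. g2 \<omega> \<partial>P) = outer_expectation P f2"
    using outer_expectation_attained[of P f2] by blast
  have "indicator A \<omega> \<le> g1 \<omega> * c1 + g2 \<omega> * c2" if "\<omega> \<in> space P" for \<omega>
  proof (cases "\<omega> \<in> A")
    case True
    then have "1 \<le> f1 \<omega> * c1 + f2 \<omega> * c2"
      by (rule bound)
    also have "\<dots> \<le> g1 \<omega> * c1 + g2 \<omega> * c2"
      using le1[OF that] le2[OF that] by (intro add_mono mult_right_mono) auto
    finally show ?thesis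
      using True by simp
  qed simp
  then have "(\<integral>\<^sup>+\<omega>. indicator A \<omega> \<partial>completion P)
      \<le> (\<integral>\<^sup>+\<omega>. g1 \<omega> * c1 + g2 \<omega> * c2 \<partial>completion P)"
    by (intro nn_integral_mono) simp
  also have "\<dots> = (\<integral>\<^sup>+\<omega>. g1 \<omega> * c1 + g2 \<omega> * c2 \<partial>P)"
    by (simp add: nn_integral_completion)
  also have "\<dots> = outer_expectation P f1 * c1 + outer_expectation P f2 * c2"
    by (simp add: nn_integral_add nn_integral_multc int1 int2)
  finally show ?thesis
    using A by simp
qed

text \<open>The maximizer enters only through its value. Outside the exceptional null set of separability,
  the maximal value exceeds a level exactly when some value on the countable separating set does,
  so the event differs from a countable union of measurable events only inside a null set.\<close>

lemma argmax_exceeds_in_completion: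
  assumes sep: "separable_random_field P \<Theta> L"
    and max: "\<And>\<omega>. \<omega> \<in> space P \<Longrightarrow> is_arg_max (\<lambda>\<theta>. L \<theta> \<omega>) (\<lambda>\<theta>. \<theta> \<in> \<Theta>) (\<theta>est \<omega>)"
    and Y [measurable]: "Y \<in> borel_measurable P"
  shows "{\<omega> \<in> space P. Y \<omega> < L (\<theta>est \<omega>) \<omega>} \<in> sets (completion P)" (is "?A \<in> _")
proof -
  have meas: "L \<theta> \<in> borel_measurable P" if "\<theta> \<in> \<Theta>" for \<theta>
    using sep that by (simp add: separable_random_field_def)
  obtain T N where T: "countable T" "T \<subseteq> \<Theta>" and N: "N \<in> null_sets P"
    and dense: "\<forall>\<omega>\<in>space P - N. \<forall>\<theta>\<in>\<Theta>. \<forall>\<epsilon>>0.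
        L \<theta> \<omega> \<in> closure ((\<lambda>\<theta>'. L \<theta>' \<omega>) ` (T \<inter> ball \<theta> \<epsilon>))"
    using sep unfolding separable_random_field_def by (elim conjE exE)
  define B where "B = (\<Union>\<theta>\<in>T. {\<omega> \<in> space P. Y \<omega> < L \<theta> \<omega>})"
  have "{\<omega> \<in> space P. Y \<omega> < L \<theta> \<omega>} \<in> sets P" if "\<theta> \<in> T" for \<theta>
    using meas[of \<theta>] that T(2) by (intro borel_measurable_less) auto
  then have B: "B \<in> sets P"
    unfolding B_def using T(1) by (intro sets.countable_UN') auto
  have "\<omega> \<in> ?A \<longleftrightarrow> \<omega> \<in> B" if \<omega>: "\<omega> \<in> space P - N" for \<omega>
  proof
    assume "\<omega> \<in> ?A"
    then have gap: "0 < L (\<theta>est \<omega>) \<omega> - Y \<omega>"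
      by simp
    have "\<theta>est \<omega> \<in> \<Theta>"
      using max[of \<omega>] \<omega> by (simp add: is_arg_max_def)
    then have "L (\<theta>est \<omega>) \<omega> \<in> closure ((\<lambda>\<theta>'. L \<theta>' \<omega>) ` (T \<inter> ball (\<theta>est \<omega>) 1))"
      using dense \<omega> zero_less_one by blast
    then have "\<exists>\<theta>\<in>T \<inter> ball (\<theta>est \<omega>) 1.
        dist (L \<theta> \<omega>) (L (\<theta>est \<omega>) \<omega>) < L (\<theta>est \<omega>) \<omega> - Y \<omega>"
      using gap by (simp add: closure_approachable)
    then obtain \<theta> where "\<theta> \<in> T" "dist (L \<theta> \<omega>) (L (\<theta>est \<omega>) \<omega>) < L (\<theta>est \<omega>) \<omega> - Y \<omega>"
      by blast
    moreover from this have "Y \<omega> < L \<theta> \<omega>"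
      by (simp add: dist_real_def)
    ultimately show "\<omega> \<in> B"
      using \<omega> by (auto simp: B_def)
  next
    assume "\<omega> \<in> B"
    then obtain \<theta> where "\<theta> \<in> T" "Y \<omega> < L \<theta> \<omega>"
      by (auto simp: B_def)
    moreover from this have "L \<theta> \<omega> \<le> L (\<theta>est \<omega>) \<omega>"
      using max[of \<omega>] \<omega> T(2) by (auto simp: is_arg_max_linorder)
    ultimately show "\<omega> \<in> ?A"
      using \<omega> by auto
  qed
  then have split: "?A = (B - N) \<union> (?A \<inter> N)"
    using sets.sets_into_space[OF B] by auto
  have "B - N \<in> sets (completion P)"
    using B null_setsD2[OF N] by (intro sets_completionI_sets sets.Diff)
  moreover have "?A \<inter> N \<in> null_sets (completion P)"
    by (rule null_sets_completion_subset[OF Int_lower2 null_sets_completionI[OF N]])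
  ultimately show ?thesis
    by (subst split) (rule sets.Un[OF _ null_setsD2])
qed

text \<open>Exponential Markov inequality in pointwise form: here \<open>m\<close>, \<open>x\<close> and \<open>k\<close> stand for the weight,
  the excess of the contrast and the rate as functions of the parameter, and \<open>c\<close> is a lower bound
  for the weight where the rate is at most \<open>r\<close>. The two summands are responsible for small and
  large rate at the parameter \<open>t\<close> with large excess. The first is the second one's shape at \<open>s = 0\<close>; the
  vanishing term is kept so that both suprema are instances of the one in \<open>Q_sup\<close>.\<close>

lemma one_le_sum_of_exp_sups:
  fixes m x k :: "'a \<Rightarrow> real"
  assumes t: "t \<in> S" and x: "z < x t" and z: "0 < z" and m: "0 < m t"
    and c: "k t \<le> r \<Longrightarrow> c \<le> m t"
    and \<rho>: "0 \<le> \<rho>" and s: "0 \<le> s"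
  shows "1 \<le> (SUP u\<in>S. ennreal (exp (\<rho> * (m u * x u + 0 * k u)))) * ennreal (exp (- \<rho> * c * z))
           + (SUP u\<in>S. ennreal (exp (\<rho> * (m u * x u + s * k u)))) * ennreal (exp (- \<rho> * s * r))"
    (is "1 \<le> ?near + ?far")
proof -
  have sup: "1 \<le> (SUP u\<in>S. ennreal (exp (h u))) * ennreal (exp (- b))" if "b \<le> h t"
    for h :: "'a \<Rightarrow> real" and b
  proof -
    have "1 \<le> ennreal (exp (h t)) * ennreal (exp (- b))"
      using that by (simp add: ennreal_mult[symmetric] exp_add[symmetric])
    also have "\<dots> \<le> (SUP u\<in>S. ennreal (exp (h u))) * ennreal (exp (- b))"
      using t by (intro mult_right_mono SUP_upper) auto
    finally show ?thesis .
  qed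
  show ?thesis
  proof (cases "k t \<le> r")
    case True
    have "c * z \<le> m t * z"
      using c[OF True] z by (intro mult_right_mono) auto
    also have "\<dots> \<le> m t * x t"
      using m x by (intro mult_left_mono) auto
    finally have "1 \<le> ?near"
      using sup[of "\<rho> * (c * z)" "\<lambda>u. \<rho> * (m u * x u + 0 * k u)"] \<rho>
      by (simp add: mult_left_mono mult.assoc)
    then show ?thesis
      by (rule add_increasing2[rotated]) simp
  next
    case False
    have "0 \<le> m t * x t"
      using m x z by simp
    moreover have "s * r \<le> s * k t"
      using False s by (intro mult_left_mono) auto
    ultimately have "s * r \<le> m t * x t + s * k t"
      by simp
    then have "1 \<le> ?far"
      using sup[of "\<rho> * (s * r)" "\<lambda>u. \<rho> * (m u * x u + s * k u)"] \<rho>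
      by (simp add: mult_left_mono mult.assoc)
    then show ?thesis
      by (rule add_increasing[rotated]) simp
  qed
qed

theorem corollary2p7:
  fixes P :: "'w measure"
    and \<Theta> :: "(real ^ 'p) set"
    and L :: "real ^ 'p \<Rightarrow> 'w \<Rightarrow> real"
    and \<theta>0 :: "real ^ 'p"
    and \<theta>est :: "'w \<Rightarrow> real ^ 'p"
    and \<mu> :: "real ^ 'p \<Rightarrow> real"
    and z \<rho> s r :: real
  assumes "prob_space P"
    and "separable_random_field P \<Theta> L"
    and "\<forall>\<theta>\<in>\<Theta>. integrable P (L \<theta>)"
    and "is_arg_max (\<lambda>\<theta>. prob_space.expectation P (L \<theta>)) (\<lambda>\<theta>. \<theta> \<in> \<Theta>) \<theta>0"
    and "\<forall>\<omega>\<in>space P. is_arg_max (\<lambda>\<theta>. L \<theta> \<omega>) (\<lambda>\<theta>. \<theta> \<in> \<Theta>) (\<theta>est \<omega>)"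
    and "\<forall>\<theta>\<in>\<Theta>. Upsilon P L \<theta>0 \<theta> \<noteq> {}"
    and "\<forall>\<theta>\<in>\<Theta>. \<mu> \<theta> \<in> Upsilon P L \<theta>0 \<theta>"
    and "z > 0"
    and "0 \<le> \<rho>" and "\<rho> < 1"
    and "0 \<le> s" and "s < 1"
    and "r > 0"
  shows "{\<omega> \<in> space P. \<theta>0 \<notin> conf_set \<Theta> L \<theta>est z \<omega>} \<in> sets (completion P) \<and>
    emeasure (completion P) {\<omega> \<in> space P. \<theta>0 \<notin> conf_set \<Theta> L \<theta>est z \<omega>}
      \<le> Q_sup P \<Theta> L \<mu> \<theta>0 \<rho> 0 * ennreal (exp (- \<rho> * mu_star P \<Theta> L \<mu> \<theta>0 r * z))
        + Q_sup P \<Theta> L \<mu> \<theta>0 \<rho> s * ennreal (exp (- \<rho> * s * r))"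
proof -
  define A where "A = {\<omega> \<in> space P. \<theta>0 \<notin> conf_set \<Theta> L \<theta>est z \<omega>}"
  have \<theta>0: "\<theta>0 \<in> \<Theta>"
    using assms(4) by (simp add: is_arg_max_def)
  have est: "\<theta>est \<omega> \<in> \<Theta>" if "\<omega> \<in> space P" for \<omega>
    using assms(5) that by (auto simp: is_arg_max_def)
  have \<mu>_pos: "0 < \<mu> \<theta>" if "\<theta> \<in> \<Theta>" for \<theta>
    using assms(7) that by (auto simp: Upsilon_def)
  have mu_star_le: "mu_star P \<Theta> L \<mu> \<theta>0 r \<le> \<mu> \<theta>"
    if "\<theta> \<in> \<Theta>" "rate_M P L \<mu> \<theta>0 \<theta> \<le> r" for \<theta>
    unfolding mu_star_def
  proof (rule cINF_lower)
    show "bdd_below (\<mu> ` local_set P \<Theta> L \<mu> r \<theta>0)"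
      by (rule bdd_belowI2[of _ 0]) (auto simp: local_set_def intro: less_imp_le \<mu>_pos)
  qed (use that in \<open>simp add: local_set_def\<close>)
  have A_excess: "A = {\<omega> \<in> space P. L \<theta>0 \<omega> + z < L (\<theta>est \<omega>) \<omega>}"
    using \<theta>0 by (auto simp: A_def conf_set_def contrast_diff_def)
  have "(\<lambda>\<omega>. L \<theta>0 \<omega> + z) \<in> borel_measurable P"
    using assms(2) \<theta>0 by (auto simp: separable_random_field_def)
  then have A: "A \<in> sets (completion P)"
    unfolding A_excess using assms(2,5) by (intro argmax_exceeds_in_completion) auto
  have "emeasure (completion P) A
      \<le> Q_sup P \<Theta> L \<mu> \<theta>0 \<rho> 0 * ennreal (exp (- \<rho> * mu_star P \<Theta> L \<mu> \<theta>0 r * z))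
        + Q_sup P \<Theta> L \<mu> \<theta>0 \<rho> s * ennreal (exp (- \<rho> * s * r))"
    unfolding Q_sup_def
  proof (rule emeasure_completion_le_outer_expectations[OF A],
      rule one_le_sum_of_exp_sups)
    fix \<omega> assume \<omega>: "\<omega> \<in> A"
    then show t: "\<theta>est \<omega> \<in> \<Theta>"
      using est by (simp add: A_def)
    show "z < contrast_diff L (\<theta>est \<omega>) \<theta>0 \<omega>"
      using \<omega> by (simp add: A_excess contrast_diff_def)
    show "0 < \<mu> (\<theta>est \<omega>)"
      using t by (rule \<mu>_pos)
    show "mu_star P \<Theta> L \<mu> \<theta>0 r \<le> \<mu> (\<theta>est \<omega>)" if "rate_M P L \<mu> \<theta>0 (\<theta>est \<omega>) \<le> r"
      using t that by (rule mu_star_le)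
  qed (use assms in auto)
  with A show ?thesis
    unfolding A_def by blast
qed

end
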